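(* Let $F=\mathbb{F}_{q^2}$ be the finite field with $q^2$ elements, let $m\ge 1$, and let $R=F[x]/\langle x^m-1\rangle$. Let $C\subseteq R^2$ be a quasi-cyclic code of length $2m$ and index $2$ over $F$, generated by $g_1=(g_{11}(x),g_{12}(x))$ and $g_2=(0,g_{22}(x))$, where $g_{11},g_{12},g_{22}\in F[x]$ satisfy: $g_{11}(x)\mid (x^m-1)$ and $g_{22}(x)\mid (x^m-1)$; $\deg g_{12}(x)<\deg g_{22}(x)$; and $g_{11}(x)g_{22}(x)\mid (x^m-1)g_{12}(x)$. Then $C$ is self-orthogonal with respect to the Hermitian inner product, i.e. $C\subseteq C^{\perp_h}$, if and only if the following conditions hold: 1) $g_{22}(x)g_{22}(x)^\dagger\equiv 0\pmod{x^m-1}$; 2) $g_{12}(x)g_{22}(x)^\dagger\equiv 0\pmod{x^m-1}$; 3) $g_{11}(x)g_{11}(x)^\dagger+g_{12}(x)g_{12}(x)^\dagger\equiv 0\pmod{x^m-1}$.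
   Context: A quasi-cyclic code of length $2m$ and index $2$ over $F$ (a linear subspace of $F^{2m}$ invariant under the square of the cyclic shift) is identified with an $R$-submodule of $R^2$: a vector $(c_{0,0},c_{0,1},c_{1,0},c_{1,1},\dots,c_{m-1,0},c_{m-1,1})$ corresponds to $(c_0(x),c_1(x))$ with $c_j(x)=\sum_{i=0}^{m-1} c_{i,j}x^i$. "Generated by" means generated as an $R$-module; polynomials are also regarded as elements of $R$ by reduction modulo $x^m-1$. Divisibility is in $F[x]$; convention $\deg 0=-\infty$, so $g_{12}=0$ is allowed. For $c\in\mathbb{F}_{q^2}$ put $\overline{c}=c^q$, and for $f=\sum a_ix^i$ put $\overline{f}(x)=\sum\overline{a_i}x^i$. For $\deg f\le m$, the conjugate transpose polynomial is $f(x)^\dagger=x^m\overline{f}(x^{-1})\in F[x]$. For $a=\sum_{i=0}^{m-1}a_ix^i$, $b=\sum_{i=0}^{m-1}b_ix^i$ in $R$, $\langle a,b\rangle_h=\sum_{i=0}^{m-1}a_i\overline{b_i}$, and $\langle (a,b),(a',b')\rangle_h=\langle a,a'\rangle_h+\langle b,b'\rangle_h$ on $R^2$. $C^{\perp_h}=\{u\in R^2:\langle u,v\rangle_h=0\text{ for all }v\in C\}$. *)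

theory Defs
  imports
    "HOL-Algebra.QuotRing"
    "HOL-Number_Theory.Cong"
    "Jordan_Normal_Form.VS_Connect"
begin

hide_const (open) Multiset.mult Polynomial.smult

section \<open>The ring \<open>R = F[x] / (x^m - 1)\<close> and the module \<open>R\<^sup>2\<close>\<close>

abbreviation cyc_poly :: "nat \<Rightarrow> 'a::field poly" where
  "cyc_poly m \<equiv> monom 1 m - 1"

definition cyc_ideal :: "nat \<Rightarrow> 'a::field poly set" where
  "cyc_ideal m = PIdl\<^bsub>class_ring\<^esub> (cyc_poly m)"

definition cyc_ring :: "nat \<Rightarrow> 'a::field poly set ring" where
  "cyc_ring m = class_ring Quot (cyc_ideal m)"

definition residue :: "nat \<Rightarrow> 'a::field poly \<Rightarrow> 'a poly set" where
  "residue m f = cyc_ideal m +>\<^bsub>class_ring\<^esub> f"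

text \<open>The representative of degree less than \<open>m\<close>; it exists and is unique for \<open>m \<ge> 1\<close>.\<close>

definition representative :: "nat \<Rightarrow> 'a::field poly set \<Rightarrow> 'a poly" where
  "representative m A = (THE f. f \<in> A \<and> degree f < m)"

text \<open>Only the module operations of \<open>R\<^sup>2\<close> are used; the fields \<open>mult\<close> and \<open>one\<close>, which the
  record type inherits from rings, are irrelevant.\<close>

definition cyc_ring_sq :: "nat \<Rightarrow> ('a::field poly set, 'a poly set \<times> 'a poly set) module" where
  "cyc_ring_sq m = \<lparr>
     carrier = carrier (cyc_ring m) \<times> carrier (cyc_ring m),
     mult = undefined,
     one = undefined,
     zero = (\<zero>\<^bsub>cyc_ring m\<^esub>, \<zero>\<^bsub>cyc_ring m\<^esub>),
     add = (\<lambda>u v. (fst u \<oplus>\<^bsub>cyc_ring m\<^esub> fst v, snd u \<oplus>\<^bsub>cyc_ring m\<^esub> snd v)),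
     smult = (\<lambda>r u. (r \<otimes>\<^bsub>cyc_ring m\<^esub> fst u, r \<otimes>\<^bsub>cyc_ring m\<^esub> snd u))\<rparr>"

abbreviation generated_by ::
    "nat \<Rightarrow> ('a::field poly set \<times> 'a poly set) set \<Rightarrow> ('a poly set \<times> 'a poly set) set" where
  "generated_by m S \<equiv> LinearCombinations.module.span (cyc_ring m) (cyc_ring_sq m) S"


section \<open>Quasi-cyclic codes of index 2\<close>

text \<open>\<open>(c\<^sub>0, \<dots>, c\<^sub>n\<^sub>-\<^sub>1) \<mapsto> (c\<^sub>n\<^sub>-\<^sub>1, c\<^sub>0, \<dots>, c\<^sub>n\<^sub>-\<^sub>2)\<close>\<close>

definition cyclic_shift :: "'a vec \<Rightarrow> 'a vec" where
  "cyclic_shift v = vec (dim_vec v) (\<lambda>i. v $ ((i + dim_vec v - 1) mod dim_vec v))"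

definition quasi_cyclic :: "nat \<Rightarrow> 'a::field vec set \<Rightarrow> bool" where
  "quasi_cyclic m D \<longleftrightarrow>
     VectorSpace.subspace class_ring D (module_vec TYPE('a) (2 * m)) \<and>
     (\<forall>v\<in>D. cyclic_shift (cyclic_shift v) \<in> D)"

text \<open>The coordinate \<open>c\<^sub>i\<^sub>,\<^sub>j\<close> of the interleaved vector is its entry number \<open>2 * i + j\<close>.\<close>

definition vec_to_pair :: "nat \<Rightarrow> 'a::field vec \<Rightarrow> 'a poly set \<times> 'a poly set" where
  "vec_to_pair m v =
     (residue m (\<Sum>i<m. monom (v $ (2 * i)) i),
      residue m (\<Sum>i<m. monom (v $ (2 * i + 1)) i))"

definition quasi_cyclic_code :: "nat \<Rightarrow> ('a::field poly set \<times> 'a poly set) set \<Rightarrow> bool" where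
  "quasi_cyclic_code m C \<longleftrightarrow> (\<exists>D. quasi_cyclic m D \<and> C = vec_to_pair m ` D)"


section \<open>Conjugation and the Hermitian inner product over the field with \<open>q\<^sup>2\<close> elements\<close>

definition conj_poly :: "nat \<Rightarrow> 'a::field poly \<Rightarrow> 'a poly" where
  "conj_poly q f = map_poly (\<lambda>c. c ^ q) f"

text \<open>This is \<open>x^m * conj_poly q f (1/x)\<close>, written out for \<open>degree f \<le> m\<close>; coefficients of
  higher order are ignored.\<close>

definition conj_transpose :: "nat \<Rightarrow> nat \<Rightarrow> 'a::field poly \<Rightarrow> 'a poly" where
  "conj_transpose q m f = (\<Sum>i\<le>m. monom (coeff (conj_poly q f) i) (m - i))"

definition herm :: "nat \<Rightarrow> nat \<Rightarrow> 'a::field poly set \<Rightarrow> 'a poly set \<Rightarrow> 'a" where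
  "herm q m a b =
     (\<Sum>i<m. coeff (representative m a) i * coeff (representative m b) i ^ q)"

definition herm_sq ::
    "nat \<Rightarrow> nat \<Rightarrow> 'a::field poly set \<times> 'a poly set \<Rightarrow> 'a poly set \<times> 'a poly set \<Rightarrow> 'a" where
  "herm_sq q m u v = herm q m (fst u) (fst v) + herm q m (snd u) (snd v)"

definition herm_dual ::
    "nat \<Rightarrow> nat \<Rightarrow> ('a::field poly set \<times> 'a poly set) set \<Rightarrow> ('a poly set \<times> 'a poly set) set" where
  "herm_dual q m C = {u \<in> carrier (cyc_ring_sq m). \<forall>v\<in>C. herm_sq q m u v = 0}"

end

theory Submission
  imports Defs "HOL-Algebra.Sylow"
begin

text \<open>
  On \<open>R\<close> the map \<open>f \<mapsto> f\<^sup>*\<close> that conjugates coefficients and substitutes \<open>x^(m - 1)\<close>, which is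
  the inverse of \<open>x\<close> modulo \<open>x^m - 1\<close>, is a ring involution, it agrees with the conjugate transpose
  in degrees up to \<open>m\<close>, and \<open>\<langle>a, b\<rangle>\<close> is the constant coefficient of \<open>a b\<^sup>*\<close>. Since \<open>h = 0\<close> in \<open>R\<close>
  as soon as all multiples of \<open>h\<close> have constant coefficient zero, a submodule of \<open>R\<^sup>2\<close> is
  self-orthogonal iff \<open>u\<^sub>1 v\<^sub>1\<^sup>* + u\<^sub>2 v\<^sub>2\<^sup>* = 0\<close> for all pairs \<open>u\<close>, \<open>v\<close> of generators. The pair
  \<open>(g\<^sub>2, g\<^sub>1)\<close> gives the image of the condition for \<open>(g\<^sub>1, g\<^sub>2)\<close> under the involution.
\<close>

section \<open>Frobenius powers in a finite field\<close>

text \<open>Multiplication by a nonzero \<open>x\<close> permutes the nonzero elements. Comparing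
  the product of these elements before and after and cancelling it leaves \<open>x\<close> to the
  power \<open>card UNIV - 1\<close> equal to 1.\<close>

lemma finite_field_power_card:
  fixes x :: "'a::{field, finite}"
  shows "x ^ card (UNIV :: 'a set) = x"
proof (cases "x = 0")
  case False
  have "bij_betw ((*) x) (UNIV - {0}) (UNIV - {0})"
    by (rule bij_betw_byWitness[where f' = "\<lambda>y. y / x"]) (use False in auto)
  from prod.reindex_bij_betw[OF this, of id]
  have "x ^ card (UNIV - {0 :: 'a}) * \<Prod>(UNIV - {0}) = 1 * \<Prod>(UNIV - {0 :: 'a})"
    by (simp add: prod.distrib)
  hence "x ^ card (UNIV - {0 :: 'a}) = 1"
    by (subst (asm) mult_cancel_right) auto
  moreover have "card (UNIV :: 'a set) = Suc (card (UNIV - {0 :: 'a}))"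
    by (rule card.remove) auto
  ultimately show ?thesis
    by (simp only: power_Suc mult_1_right)
qed (simp add: finite_UNIV_card_ge_0)

text \<open>Cauchy's theorem for the additive group gives a subgroup \<open>H\<close> of order
  \<open>r\<close>. Translation by a nonzero \<open>x\<close> in \<open>H\<close> permutes
  \<open>H\<close>, so comparing sums over \<open>H\<close> yields
  \<open>of_nat r * x = 0\<close>.\<close>

lemma prime_dvd_card_eq_CHAR:
  assumes "prime r" and "r dvd card (UNIV :: 'a::{field, finite} set)"
  shows "r = CHAR('a)"
proof -
  define G where "G = \<lparr>carrier = (UNIV :: 'a set), monoid.mult = (+), one = (0 :: 'a)\<rparr>"
  interpret group G
  proof (rule groupI)
    fix x assume "x \<in> carrier G"
    show "\<exists>y\<in>carrier G. y \<otimes>\<^bsub>G\<^esub> x = \<one>\<^bsub>G\<^esub>"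
      by (intro bexI[of _ "-x"]) (auto simp: G_def)
  qed (auto simp: G_def add_ac)
  obtain k where "card (UNIV :: 'a set) = r * k"
    using assms(2) by blast
  hence "Coset.order G = r ^ 1 * k"
    by (simp add: Coset.order_def G_def)
  \<comment> \<open>The exponent 1 turns Sylow's theorem into Cauchy's; \<open>k\<close> may still
    be divisible by \<open>r\<close>.\<close>
  then obtain H where H: "subgroup H G" "card H = r ^ 1"
    using sylow_thm[OF \<open>prime r\<close> is_group, of 1 k] by (auto simp: G_def)
  have "\<not> H \<subseteq> {0}"
    using H(2) card_mono[of "{0 :: 'a}" H] prime_gt_1_nat[OF \<open>prime r\<close>] by auto
  then obtain x where x: "x \<in> H" "x \<noteq> 0"
    by blast
  have "(+) x ` H \<subseteq> H"
    using subgroup.m_closed[OF H(1)] x(1) by (auto simp: G_def)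
  hence "bij_betw ((+) x) H H"
    by (intro bij_betw_imageI endo_inj_surj) auto
  from sum.reindex_bij_betw[OF this, of id] have "(\<Sum>h\<in>H. x + h) = \<Sum>H"
    by simp
  hence "of_nat r * x = 0"
    using H(2) by (simp add: sum.distrib)
  hence "of_nat r = (0 :: 'a)"
    using x(2) by simp
  hence "CHAR('a) dvd r"
    by (simp add: of_nat_eq_0_iff_char_dvd)
  moreover have "CHAR('a) \<noteq> 1"
    by simp
  ultimately show ?thesis
    using \<open>prime r\<close> by (metis prime_nat_iff)
qed

section \<open>Polynomials modulo \<open>x^m - 1\<close>\<close>

lemma degree_cyc_poly: "m \<ge> 1 \<Longrightarrow> degree (cyc_poly m :: 'a::field poly) = m"
  using degree_add_eq_left[of "-1" "monom (1 :: 'a) m"] by (simp add: degree_monom_eq)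

lemma cyc_poly_nonzero: "m \<ge> 1 \<Longrightarrow> (cyc_poly m :: 'a::field poly) \<noteq> 0"
  using degree_cyc_poly[of m, where ?'a = 'a] by fastforce

lemma degree_mod_cyc_poly: "m \<ge> 1 \<Longrightarrow> degree (f mod cyc_poly m :: 'a::field poly) < m"
  using degree_mod_less[OF cyc_poly_nonzero, of m f] degree_cyc_poly[of m, where ?'a = 'a] by auto

lemma cong_monom_mod: "[monom c n = monom c (n mod m)] (mod (cyc_poly m :: 'a::field poly))"
proof -
  have "[monom 1 m = (1 :: 'a poly)] (mod (cyc_poly m))"
    by (simp add: cong_iff_dvd_diff)
  hence "[monom c (n mod m) * monom 1 m ^ (n div m) = monom c (n mod m) * 1 ^ (n div m)]
      (mod (cyc_poly m :: 'a poly))"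
    by (intro cong_mult cong_pow cong_refl)
  thus ?thesis
    by (simp add: monom_power mult_monom)
qed

lemma cong_monom:
  assumes "[i = j] (mod m)"
  shows "[monom c i = monom c j] (mod (cyc_poly m :: 'a::field poly))"
  using cong_monom_mod[of c i m] cong_monom_mod[of c j m] assms
  by (metis cong_def)

lemma monom_mod_cyc_poly:
  assumes "m \<ge> 1"
  shows "monom c n mod cyc_poly m = (monom c (n mod m) :: 'a::field poly)"
proof -
  have "degree (monom c (n mod m)) < degree (cyc_poly m :: 'a poly)"
    using assms degree_monom_le[of c "n mod m"]
    by (simp add: degree_cyc_poly le_less_trans)
  thus ?thesis
    using cong_monom_mod[of c n m] by (simp add: cong_def mod_poly_less)
qed

text \<open>For \<open>m \<ge> 1\<close> this is the standard trace of the group algebra of the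
  cyclic group of order \<open>m\<close>, namely the coefficient at the identity, lifted to
  polynomials.\<close>

definition const_coeff :: "nat \<Rightarrow> 'a::field poly \<Rightarrow> 'a" where
  "const_coeff m f = coeff (f mod cyc_poly m) 0"

lemma const_coeff_cong: "[f = g] (mod (cyc_poly m)) \<Longrightarrow> const_coeff m f = const_coeff m g"
  by (simp add: const_coeff_def cong_def)

lemma const_coeff_zero [simp]: "const_coeff m 0 = 0"
  by (simp add: const_coeff_def)

lemma const_coeff_add: "const_coeff m (f + g) = const_coeff m f + const_coeff m g"
  by (simp add: const_coeff_def poly_mod_add_left)

lemma const_coeff_sum: "const_coeff m (sum f A) = (\<Sum>i\<in>A. const_coeff m (f i))"
  by (induction A rule: infinite_finite_induct) (auto simp: const_coeff_add)

lemma const_coeff_smult: "const_coeff m (Polynomial.smult c f) = c * const_coeff m f"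
  by (simp add: const_coeff_def mod_smult_left)

lemma const_coeff_monom:
  "m \<ge> 1 \<Longrightarrow> const_coeff m (monom c n) = (if m dvd n then c else 0)"
  by (auto simp: const_coeff_def monom_mod_cyc_poly)

lemma poly_eq_sum_monoms_less:
  assumes "degree f < m"
  shows "f = (\<Sum>i<m. monom (coeff f i) i)"
  using poly_as_sum_of_monoms'[of f "m - 1"] assms
  by (cases m) (auto simp: lessThan_Suc_atMost)

text \<open>The monomial with exponent \<open>(m - 1) * i\<close> is the inverse of
  \<open>x^i\<close> modulo \<open>x^m - 1\<close>, so multiplying by it moves coefficient
  \<open>i\<close> to position 0.\<close>

lemma coeff_mod_eq_const_coeff:
  fixes a :: "'a::field poly"
  assumes "i < m"
  shows "coeff (a mod cyc_poly m) i = const_coeff m (a * monom 1 ((m - 1) * i))"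
proof -
  define f where "f = a mod cyc_poly m"
  have m: "m \<ge> 1"
    using assms by simp
  have f: "f = (\<Sum>j<m. monom (coeff f j) j)"
    unfolding f_def by (intro poly_eq_sum_monoms_less degree_mod_cyc_poly m)
  have dvd_iff: "m dvd j + (m - 1) * i \<longleftrightarrow> j = i" if "j < m" for j
  proof -
    \<comment> \<open>Adding \<open>i\<close> completes the exponent to \<open>j + m * i\<close>
      without subtraction; since \<open>i\<close> and \<open>j\<close> are below \<open>m\<close>,
      congruence then means equality.\<close>
    have "m dvd j + (m - 1) * i \<longleftrightarrow> [j + (m - 1) * i + i = 0 + i] (mod m)"
      by (simp only: cong_add_rcancel_nat cong_0_iff)
    also have "j + (m - 1) * i + i = j + m * i"
      using m by (cases m) auto
    also have "[j + m * i = 0 + i] (mod m) \<longleftrightarrow> j = i"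
      using that assms by (simp add: cong_def)
    finally show ?thesis .
  qed
  have "[a = f] (mod (cyc_poly m))"
    by (simp add: f_def cong_def)
  hence "const_coeff m (a * monom 1 ((m - 1) * i)) = const_coeff m (f * monom 1 ((m - 1) * i))"
    by (intro const_coeff_cong cong_mult cong_refl)
  also have "f * monom 1 ((m - 1) * i) = (\<Sum>j<m. monom (coeff f j) (j + (m - 1) * i))"
    by (subst f) (simp add: sum_distrib_right mult_monom)
  also have "const_coeff m \<dots> = (\<Sum>j<m. if j = i then coeff f j else 0)"
    unfolding const_coeff_sum const_coeff_monom[OF m]
    by (intro sum.cong refl) (simp only: lessThan_iff dvd_iff)
  also have "\<dots> = coeff f i"
    using assms by simp
  finally show ?thesis
    by (simp add: f_def)
qed

text \<open>Nondegeneracy of the trace form: taking powers of \<open>x\<close> as multipliers reads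
  off every coefficient of the remainder of \<open>h\<close>.\<close>

lemma dvd_iff_const_coeff_multiples_zero:
  fixes h :: "'a::field poly"
  assumes "m \<ge> 1"
  shows "cyc_poly m dvd h \<longleftrightarrow> (\<forall>r. const_coeff m (r * h) = 0)"
proof
  assume "cyc_poly m dvd h"
  thus "\<forall>r. const_coeff m (r * h) = 0"
    by (auto simp: const_coeff_def)
next
  assume *: "\<forall>r. const_coeff m (r * h) = 0"
  have "coeff (h mod cyc_poly m) i = 0" for i
  proof (cases "i < m")
    case True
    thus ?thesis
      using * by (simp add: coeff_mod_eq_const_coeff mult.commute[of h])
  next
    case False
    thus ?thesis
      using degree_mod_cyc_poly[OF assms, of h] by (intro coeff_eq_0) simp
  qed
  hence "h mod cyc_poly m = 0"
    by (simp add: poly_eq_iff)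
  thus "cyc_poly m dvd h"
    by (rule mod_0_imp_dvd)
qed

lemma pcompose_monom_monom:
  "pcompose (monom c i) (monom 1 k) = (monom c (k * i) :: 'a::comm_semiring_1 poly)"
proof (induction i)
  case 0
  show ?case
    by (simp add: monom_0)
next
  case (Suc i)
  thus ?case
    by (simp add: monom_Suc pcompose_pCons mult_monom)
qed

lemma pcompose_cong:
  fixes f :: "'a::field poly"
  assumes "[a = b] (mod p)"
  shows "[pcompose f a = pcompose f b] (mod p)"
  by (induction f) (auto simp: pcompose_pCons intro!: cong_add cong_mult assms)

section \<open>The conjugate reciprocal\<close>

text \<open>Substitution in place of reversal of coefficients makes the map additive and
  multiplicative on polynomials themselves, in every degree, once \<open>q ^ 2\<close> is the size
  of the field.\<close>

definition conj_recip :: "nat \<Rightarrow> nat \<Rightarrow> 'a::field poly \<Rightarrow> 'a poly" where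
  "conj_recip q m f = pcompose (conj_poly q f) (monom 1 (m - 1))"

context
  fixes q :: nat
  assumes card_UNIV: "card (UNIV :: 'a::{field, finite} set) = q ^ 2"
begin

section \<open>Conjugation of coefficients as a ring involution\<close>

lemma q_pos: "q > 0"
  using card_UNIV finite_UNIV_card_ge_0[where ?'a = 'a] by (cases "q = 0") auto

lemma coeff_conj_poly: "coeff (conj_poly q (f :: 'a poly)) i = coeff f i ^ q"
  using q_pos by (simp add: conj_poly_def coeff_map_poly)

lemma conj_poly_monom: "conj_poly q (monom c i :: 'a poly) = monom (c ^ q) i"
  using q_pos by (simp add: conj_poly_def map_poly_monom)

lemma prime_CHAR: "prime CHAR('a)"
  by (rule prime_CHAR_semidom) (simp add: finite_imp_CHAR_pos)

text \<open>Every prime factor of \<open>q\<close> divides the size \<open>q ^ 2\<close> of the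
  field, hence equals the characteristic. This makes \<open>c \<mapsto> c ^ q\<close> an iterated
  Frobenius map, so it is additive.\<close>

lemma q_eq_CHAR_power: "\<exists>k. q = CHAR('a) ^ k"
proof -
  have "r = CHAR('a)" if "prime r" "r dvd q" for r
    using that by (intro prime_dvd_card_eq_CHAR) (auto simp: card_UNIV power2_eq_square)
  hence "prime_factors q \<subseteq> {CHAR('a)}"
    by (auto simp: in_prime_factors_iff)
  hence "set_mset (prime_factorization q) \<subseteq> {CHAR('a)}"
    by simp
  then obtain k where "prime_factorization q = replicate_mset k CHAR('a)"
    by (meson set_mset_subset_singletonD)
  hence "q = CHAR('a) ^ k"
    using prod_mset_prime_factorization_nat[of q] q_pos by simp
  thus ?thesis ..
qed

lemma frobenius_add: "(x + y) ^ q = x ^ q + (y :: 'a) ^ q"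
  using q_eq_CHAR_power freshmans_dream'[OF prime_CHAR] by blast

lemma frobenius_sum: "(\<Sum>i\<in>A. f i :: 'a) ^ q = (\<Sum>i\<in>A. f i ^ q)"
  using q_eq_CHAR_power freshmans_dream_sum'[OF prime_CHAR] by blast

lemma frobenius_square: "((x :: 'a) ^ q) ^ q = x"
  using finite_field_power_card[of x] card_UNIV by (simp add: power_mult power2_eq_square)

lemma conj_poly_add: "conj_poly q (f + g :: 'a poly) = conj_poly q f + conj_poly q g"
  by (rule poly_eqI) (simp add: coeff_conj_poly frobenius_add)

lemma conj_poly_mult: "conj_poly q (f * g :: 'a poly) = conj_poly q f * conj_poly q g"
  by (rule poly_eqI)
    (simp add: coeff_conj_poly coeff_mult frobenius_sum power_mult_distrib)

lemma conj_poly_conj_poly: "conj_poly q (conj_poly q f) = (f :: 'a poly)"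
  by (rule poly_eqI) (simp add: coeff_conj_poly frobenius_square)

text \<open>Conjugation respects sums and products, so it passes through the Horner scheme. This is
  what allows \<open>conj_recip\<close> to be iterated.\<close>

lemma conj_poly_pcompose:
  "conj_poly q (pcompose f g :: 'a poly) = pcompose (conj_poly q f) (conj_poly q g)"
proof (induction f)
  case 0
  show ?case
    by (simp add: conj_poly_def)
next
  case (pCons a f)
  have "conj_poly q [:c:] = [:c ^ q:]" "conj_poly q (pCons c f) = pCons (c ^ q) (conj_poly q f)"
    for c :: 'a and f
    using q_pos by (auto simp: conj_poly_def map_poly_pCons)
  thus ?case
    by (simp add: pcompose_pCons conj_poly_add conj_poly_mult pCons.IH)
qed

section \<open>The conjugate reciprocal as an involution modulo \<open>x^m - 1\<close>\<close>

lemma conj_recip_add: "conj_recip q m (f + g :: 'a poly) = conj_recip q m f + conj_recip q m g"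
  by (simp add: conj_recip_def conj_poly_add pcompose_add)

lemma conj_recip_mult: "conj_recip q m (f * g :: 'a poly) = conj_recip q m f * conj_recip q m g"
  by (simp add: conj_recip_def conj_poly_mult pcompose_mult)

lemma conj_recip_zero [simp]: "conj_recip q m (0 :: 'a poly) = 0"
  by (simp add: conj_recip_def conj_poly_def)

lemma conj_recip_monom: "conj_recip q m (monom c i :: 'a poly) = monom (c ^ q) ((m - 1) * i)"
  by (simp add: conj_recip_def conj_poly_monom pcompose_monom_monom)

lemma conj_recip_sum:
  "conj_recip q m (\<Sum>i\<in>A. f i :: 'a poly) = (\<Sum>i\<in>A. conj_recip q m (f i))"
  by (induction A rule: infinite_finite_induct) (auto simp: conj_recip_add)

text \<open>The image of \<open>x^m - 1\<close> is \<open>x^((m - 1) * m) - 1\<close>, again a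
  multiple of \<open>x^m - 1\<close>; multiplicativity extends this to all multiples. Hence
  \<open>conj_recip\<close> descends to the quotient ring.\<close>

lemma cyc_poly_dvd_conj_recip:
  assumes "cyc_poly m dvd (f :: 'a poly)"
  shows "cyc_poly m dvd conj_recip q m f"
proof -
  obtain g where "f = cyc_poly m * g"
    using assms by blast
  moreover have "cyc_poly m dvd conj_recip q m (cyc_poly m :: 'a poly)"
  proof -
    \<comment> \<open>The image of the difference is obtained from additivity by adding back the
      image of 1.\<close>
    have "conj_recip q m (cyc_poly m :: 'a poly) + conj_recip q m 1 = conj_recip q m (monom 1 m)"
      by (simp flip: conj_recip_add)
    moreover have "conj_recip q m 1 = (1 :: 'a poly)"
      using conj_recip_monom[of m 1 0] by simp
    ultimately have "conj_recip q m (cyc_poly m :: 'a poly) = monom 1 ((m - 1) * m) - monom 1 0"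
      by (simp add: conj_recip_monom eq_diff_eq)
    moreover have "[monom 1 ((m - 1) * m) = monom (1 :: 'a) 0] (mod (cyc_poly m))"
      by (intro cong_monom) (simp add: cong_def)
    ultimately show ?thesis
      by (simp add: cong_iff_dvd_diff)
  qed
  ultimately show ?thesis
    by (simp add: conj_recip_mult)
qed

lemma conj_recip_cong:
  assumes "[f = g] (mod (cyc_poly m :: 'a poly))"
  shows "[conj_recip q m f = conj_recip q m g] (mod (cyc_poly m))"
proof -
  have "conj_recip q m f = conj_recip q m (f - g) + conj_recip q m g"
    by (simp flip: conj_recip_add)
  thus ?thesis
    using cyc_poly_dvd_conj_recip[of m "f - g"] assms by (simp add: cong_iff_dvd_diff)
qed

text \<open>Conjugating coefficients twice is the identity, and the double substitution replaces
  \<open>x\<close> by its power with exponent \<open>(m - 1) * (m - 1)\<close>, which is 1 modulo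
  \<open>m\<close>.\<close>

lemma conj_recip_conj_recip:
  assumes "m \<ge> 1"
  shows "[conj_recip q m (conj_recip q m f) = (f :: 'a poly)] (mod (cyc_poly m))"
proof -
  have "conj_recip q m (conj_recip q m f) = pcompose f (monom 1 ((m - 1) * (m - 1)))"
    using q_pos
    by (simp add: conj_recip_def conj_poly_pcompose conj_poly_conj_poly conj_poly_monom
        pcompose_monom_monom flip: pcompose_assoc)
  moreover have "[(m - 1) * (m - 1) = 1] (mod m)"
  proof -
    have "(m - 1) * (m - 1) + (m - 1) = m * (m - 1)" "1 + (m - 1) = m"
      using assms by (cases m; simp)+
    hence "[(m - 1) * (m - 1) + (m - 1) = 1 + (m - 1)] (mod m)"
      by (simp only: cong_def) simp
    thus ?thesis
      by (simp only: cong_add_rcancel_nat)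
  qed
  ultimately show ?thesis
    using pcompose_cong[OF cong_monom, of "(m - 1) * (m - 1)" 1 m f 1]
    by (simp add: monom_altdef)
qed

text \<open>Coefficient \<open>i\<close> lands at exponent \<open>m - i\<close> on one side and
  \<open>(m - 1) * i\<close> on the other, and these agree modulo \<open>m\<close>. The degree bound
  matters because \<open>conj_transpose\<close> drops coefficients beyond \<open>m\<close>.\<close>

lemma conj_transpose_cong_conj_recip:
  assumes "m \<ge> 1" and "degree (f :: 'a poly) \<le> m"
  shows "[conj_transpose q m f = conj_recip q m f] (mod (cyc_poly m))"
proof -
  have exponents: "[m - i = (m - 1) * i] (mod m)" if "i \<le> m" for i
  proof -
    have "(m - 1) * i + i = m * i"
      using assms(1) by (cases m) auto
    hence "[m - i + i = (m - 1) * i + i] (mod m)"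
      using that by (simp add: cong_def)
    thus ?thesis
      by (simp only: cong_add_rcancel_nat)
  qed
  have "f = (\<Sum>i\<le>m. monom (coeff f i) i)"
    using poly_as_sum_of_monoms'[OF assms(2)] by simp
  hence recip: "conj_recip q m f = (\<Sum>i\<le>m. monom (coeff f i ^ q) ((m - 1) * i))"
    by (metis (no_types, lifting) conj_recip_sum conj_recip_monom sum.cong)
  show ?thesis
    unfolding conj_transpose_def coeff_conj_poly recip
    by (intro cong_sum cong_monom exponents) simp
qed

text \<open>Coefficient \<open>i\<close> of the remainder of \<open>a\<close> is the trace of
  \<open>a\<close> times the inverse of \<open>x^i\<close>. Weighting by the conjugated coefficients
  of \<open>b\<close> and summing assembles \<open>conj_recip q m b\<close> inside the
  trace.\<close>

lemma herm_eq_const_coeff: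
  assumes "m \<ge> 1"
    and "representative m A = a mod cyc_poly m"
    and "representative m B = (b :: 'a poly) mod cyc_poly m"
  shows "herm q m A B = const_coeff m (a * conj_recip q m b)"
proof -
  let ?b = "b mod cyc_poly m"
  have b: "?b = (\<Sum>i<m. monom (coeff ?b i) i)"
    by (intro poly_eq_sum_monoms_less degree_mod_cyc_poly assms(1))
  have "conj_recip q m ?b = (\<Sum>i<m. Polynomial.smult (coeff ?b i ^ q) (monom 1 ((m - 1) * i)))"
    by (subst b) (simp add: conj_recip_sum conj_recip_monom smult_monom)
  hence "const_coeff m (a * conj_recip q m ?b) =
      (\<Sum>i<m. coeff ?b i ^ q * const_coeff m (a * monom 1 ((m - 1) * i)))"
    by (simp add: sum_distrib_left const_coeff_sum const_coeff_smult)
  also have "\<dots> = herm q m A B"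
    unfolding herm_def assms(2,3)
    by (intro sum.cong) (auto simp: coeff_mod_eq_const_coeff)
  finally have "herm q m A B = const_coeff m (a * conj_recip q m ?b)"
    by simp
  also have "\<dots> = const_coeff m (a * conj_recip q m b)"
    by (intro const_coeff_cong cong_mult cong_refl conj_recip_cong) (simp add: cong_def)
  finally show ?thesis .
qed

end

section \<open>The module \<open>R\<^sup>2\<close>\<close>

lemma cyc_ideal_ideal: "ideal (cyc_ideal m :: 'a::field poly set) class_ring"
  unfolding cyc_ideal_def by (rule cring.cgenideal_ideal[OF class_cring.is_cring]) simp

lemma cyc_ring_cring: "cring (cyc_ring m :: 'a::field poly set ring)"
  unfolding cyc_ring_def
  by (rule ideal.quotient_is_cring[OF cyc_ideal_ideal class_cring.is_cring])

lemma residue_ring_hom: "residue m \<in> Ring.ring_hom class_ring (cyc_ring m)"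
  using ideal.rcos_ring_hom[OF cyc_ideal_ideal, of m]
  unfolding cyc_ring_def residue_def[abs_def] by simp

lemma residue_add:
  "residue m f \<oplus>\<^bsub>cyc_ring m\<^esub> residue m g = residue m (f + g :: 'a::field poly)"
  using ring_hom_add[OF residue_ring_hom, of f g m] by simp

lemma residue_mult:
  "residue m f \<otimes>\<^bsub>cyc_ring m\<^esub> residue m g = residue m (f * g :: 'a::field poly)"
  using ring_hom_mult[OF residue_ring_hom, of f g m] by simp

lemma carrier_cyc_ring: "carrier (cyc_ring m) = range (residue m :: 'a::field poly \<Rightarrow> _)"
  by (auto simp: cyc_ring_def FactRing_def A_RCOSETS_def' residue_def)

lemma zero_cyc_ring: "\<zero>\<^bsub>cyc_ring m\<^esub> = residue m (0 :: 'a::field poly)"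
  by (rule ring_hom_zero[OF residue_ring_hom class_ring.ring_axioms
        cring.axioms(1)[OF cyc_ring_cring], simplified, symmetric])

lemma in_residue_iff: "g \<in> residue m f \<longleftrightarrow> [g = f] (mod (cyc_poly m :: 'a::field poly))"
proof -
  have "g \<in> residue m f \<longleftrightarrow> (\<exists>h. g = h * cyc_poly m + f)"
    by (auto simp: residue_def a_r_coset_def' cyc_ideal_def cgenideal_def)
  also have "\<dots> \<longleftrightarrow> (\<exists>h. g - f = cyc_poly m * h)"
    by (simp add: diff_eq_eq mult.commute)
  finally show ?thesis
    by (simp add: cong_iff_dvd_diff dvd_def)
qed

lemma representative_residue:
  assumes "m \<ge> 1"
  shows "representative m (residue m f) = (f mod cyc_poly m :: 'a::field poly)"
  unfolding representative_def
proof (rule the_equality)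
  show "f mod cyc_poly m \<in> residue m f \<and> degree (f mod cyc_poly m) < m"
    using assms by (simp add: in_residue_iff degree_mod_cyc_poly cong_def)
next
  fix g assume "g \<in> residue m f \<and> degree g < m"
  thus "g = f mod cyc_poly m"
    using assms mod_poly_less[of g "cyc_poly m"]
    by (simp add: in_residue_iff cong_def degree_cyc_poly)
qed

definition residue_pair :: "nat \<Rightarrow> 'a::field poly \<Rightarrow> 'a poly \<Rightarrow> 'a poly set \<times> 'a poly set" where
  "residue_pair m a b = (residue m a, residue m b)"

lemma carrier_cyc_ring_sq:
  "carrier (cyc_ring_sq m) = {residue_pair m a b | a b :: 'a::field poly. True}"
  by (auto simp: cyc_ring_sq_def carrier_cyc_ring residue_pair_def)

lemma cyc_ring_sq_ops:
  shows "residue_pair m a b \<oplus>\<^bsub>cyc_ring_sq m\<^esub> residue_pair m c d = residue_pair m (a + c) (b + d)"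
    and "residue m r \<odot>\<^bsub>cyc_ring_sq m\<^esub> residue_pair m a b = residue_pair m (r * a) (r * b)"
    and "\<zero>\<^bsub>cyc_ring_sq m\<^esub> = residue_pair m 0 (0 :: 'a::field poly)"
  by (simp_all add: cyc_ring_sq_def residue_pair_def residue_add residue_mult zero_cyc_ring)

lemma cyc_ring_sq_module: "module (cyc_ring m) (cyc_ring_sq m :: ('a::field poly set, _) module)"
proof -
  interpret cring "cyc_ring m :: 'a poly set ring"
    by (rule cyc_ring_cring)
  show ?thesis
  proof (rule module_criteria, goal_cases)
    \<comment> \<open>Additive inverses are the one module axiom that needs a witness; the others
      are ring laws in each component.\<close>
    case 4
    show ?case
    proof
      fix v assume "v \<in> carrier (cyc_ring_sq m :: ('a poly set, _) module)"
      then obtain a b where "v = residue_pair m a b"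
        by (auto simp: carrier_cyc_ring_sq)
      thus "\<exists>w\<in>carrier (cyc_ring_sq m). v \<oplus>\<^bsub>cyc_ring_sq m\<^esub> w = \<zero>\<^bsub>cyc_ring_sq m\<^esub>"
        by (intro bexI[of _ "residue_pair m (- a) (- b)"])
          (auto simp: cyc_ring_sq_ops carrier_cyc_ring_sq)
    qed
  qed (auto simp: cyc_ring_sq_def m_assoc a_assoc a_comm a_lcomm l_distr r_distr cyc_ring_cring)
qed

text \<open>Since \<open>residue m\<close> is onto, polynomials can serve as coefficients. The set
  \<open>N\<close> is a submodule containing both generators, and each of its elements is visibly a
  combination of them.\<close>

lemma generated_by_two:
  fixes m :: nat and g11 g12 g22 :: "'a::field poly"
  defines "N \<equiv> {residue_pair m (r * g11) (r * g12 + s * g22) | r s. True}"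
  shows "generated_by m {residue_pair m g11 g12, residue_pair m 0 g22} = N"
    (is "LinearCombinations.module.span ?R ?M ?S = N")
proof -
  interpret Module.module ?R ?M
    by (rule cyc_ring_sq_module)
  have S: "?S \<subseteq> carrier ?M"
    by (auto simp: carrier_cyc_ring_sq)
  have N: "submodule ?R N ?M"
  proof (rule submodule.intro)
    show "module ?R ?M"
      by (rule cyc_ring_sq_module)
    show "N \<subseteq> carrier ?M"
      by (auto simp: N_def carrier_cyc_ring_sq)
    show "\<zero>\<^bsub>?M\<^esub> \<in> N"
      unfolding N_def cyc_ring_sq_ops by (rule CollectI, rule exI[of _ 0], rule exI[of _ 0]) simp
  next
    fix v w assume "v \<in> N" "w \<in> N"
    then obtain r s r' s' where "v = residue_pair m (r * g11) (r * g12 + s * g22)"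
      "w = residue_pair m (r' * g11) (r' * g12 + s' * g22)"
      by (auto simp: N_def)
    hence "v \<oplus>\<^bsub>?M\<^esub> w = residue_pair m ((r + r') * g11) ((r + r') * g12 + (s + s') * g22)"
      by (simp add: cyc_ring_sq_ops algebra_simps)
    thus "v \<oplus>\<^bsub>?M\<^esub> w \<in> N"
      unfolding N_def by blast
  next
    fix c v assume "c \<in> carrier ?R" "v \<in> N"
    then obtain t r s where "c = residue m t" "v = residue_pair m (r * g11) (r * g12 + s * g22)"
      by (auto simp: N_def carrier_cyc_ring)
    hence "c \<odot>\<^bsub>?M\<^esub> v = residue_pair m ((t * r) * g11) ((t * r) * g12 + (t * s) * g22)"
      by (simp add: cyc_ring_sq_ops algebra_simps)
    thus "c \<odot>\<^bsub>?M\<^esub> v \<in> N"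
      unfolding N_def by blast
  qed
  have "?S \<subseteq> N"
  proof -
    have "residue_pair m g11 g12 = residue_pair m (1 * g11) (1 * g12 + 0 * g22)"
      "residue_pair m 0 g22 = residue_pair m (0 * g11) (0 * g12 + 1 * g22)"
      by simp_all
    thus ?thesis
      unfolding N_def by blast
  qed
  hence "span ?S \<subseteq> N"
    by (rule span_is_subset[OF _ N])
  moreover have "N \<subseteq> span ?S"
  proof
    fix v assume "v \<in> N"
    then obtain r s where "v = residue_pair m (r * g11) (r * g12 + s * g22)"
      by (auto simp: N_def)
    hence v: "v = residue m r \<odot>\<^bsub>?M\<^esub> residue_pair m g11 g12
        \<oplus>\<^bsub>?M\<^esub> residue m s \<odot>\<^bsub>?M\<^esub> residue_pair m 0 g22"
      by (simp add: cyc_ring_sq_ops)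
    interpret span: submodule ?R "span ?S" ?M
      by (rule span_is_submodule[OF S])
    show "v \<in> span ?S"
      unfolding v using in_own_span[OF S]
      by (intro span.m_closed span.smult_closed) (auto simp: carrier_cyc_ring)
  qed
  ultimately show ?thesis
    by blast
qed

section \<open>The Hermitian form on pairs and the self-orthogonality criterion\<close>

lemma herm_sq_residue_pair:
  assumes "card (UNIV :: 'a::{field, finite} set) = q ^ 2" and "m \<ge> 1"
  shows "herm_sq q m (residue_pair m a b) (residue_pair m c d) =
    const_coeff m (a * conj_recip q m c + b * conj_recip q m (d :: 'a poly))"
  using assms(2)
  by (simp add: herm_sq_def residue_pair_def herm_eq_const_coeff[OF assms] representative_residue
      const_coeff_add)

theorem theorem6p6:
  fixes q m :: nat
    and g11 g12 g22 :: "'a::{field, finite} poly"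
    and C :: "('a poly set \<times> 'a poly set) set"
  assumes "card (UNIV :: 'a set) = q ^ 2"
    and "m \<ge> 1"
    and "quasi_cyclic_code m C"
    and "C = generated_by m {(residue m g11, residue m g12), (residue m 0, residue m g22)}"
    and "g11 dvd cyc_poly m"
    and "g22 dvd cyc_poly m"
    and "g12 = 0 \<or> degree g12 < degree g22"
    and "g11 * g22 dvd cyc_poly m * g12"
  shows "C \<subseteq> herm_dual q m C \<longleftrightarrow>
    [g22 * conj_transpose q m g22 = 0] (mod (cyc_poly m)) \<and>
    [g12 * conj_transpose q m g22 = 0] (mod (cyc_poly m)) \<and>
    [g11 * conj_transpose q m g11 + g12 * conj_transpose q m g12 = 0] (mod (cyc_poly m))"
proof -
  note card = assms(1)
  let ?P = "cyc_poly m :: 'a poly" and ?J = "conj_recip q m"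
  let ?u = "\<lambda>r s. residue_pair m (r * g11) (r * g12 + s * g22)"
  have C: "C = {?u r s | r s. True}"
    using assms(4) generated_by_two[of m g11 g12 g22] by (simp add: residue_pair_def)
  have deg: "degree g11 \<le> m" "degree g22 \<le> m"
    using dvd_imp_degree_le[OF assms(5)] dvd_imp_degree_le[OF assms(6)] cyc_poly_nonzero[OF assms(2)]
      degree_cyc_poly[OF assms(2), where ?'a = 'a] by simp_all
  \<comment> \<open>The case \<open>g12 = 0\<close> is covered because \<open>degree 0 = 0\<close>
    here.\<close>
  hence "degree g12 \<le> m"
    using assms(7) by auto
  note transpose = conj_transpose_cong_conj_recip[OF card assms(2)]
  have to_dvd: "[g22 * conj_transpose q m g22 = 0] (mod ?P) \<longleftrightarrow> ?P dvd g22 * ?J g22"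
    "[g12 * conj_transpose q m g22 = 0] (mod ?P) \<longleftrightarrow> ?P dvd g12 * ?J g22"
    "[g11 * conj_transpose q m g11 + g12 * conj_transpose q m g12 = 0] (mod ?P) \<longleftrightarrow>
      ?P dvd g11 * ?J g11 + g12 * ?J g12"
    unfolding cong_0_iff
    by (intro cong_dvd_iff cong_add cong_mult cong_refl transpose deg \<open>degree g12 \<le> m\<close>)+
  have self_orth: "C \<subseteq> herm_dual q m C \<longleftrightarrow> (\<forall>r s r' s'. herm_sq q m (?u r s) (?u r' s') = 0)"
  proof -
    have "C \<subseteq> carrier (cyc_ring_sq m)"
      unfolding C carrier_cyc_ring_sq by blast
    hence "C \<subseteq> herm_dual q m C \<longleftrightarrow> (\<forall>u\<in>C. \<forall>v\<in>C. herm_sq q m u v = 0)"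
      unfolding herm_dual_def by blast
    thus ?thesis
      unfolding C by blast
  qed
  note herm = herm_sq_residue_pair[OF card assms(2)]
  show ?thesis
    unfolding self_orth to_dvd
  proof (intro iffI conjI allI)
    assume orth: "\<forall>r s r' s'. herm_sq q m (?u r s) (?u r' s') = 0"
    \<comment> \<open>In each of the three instances the right vector is a fixed generator and one
      multiplier on the left stays free, so all multiples of the relevant product have trace
      zero.\<close>
    show "?P dvd g22 * ?J g22"
      unfolding dvd_iff_const_coeff_multiples_zero[OF assms(2)]
      using orth[rule_format, of 0 _ 0 1] by (simp add: herm mult.assoc)
    show "?P dvd g12 * ?J g22"
      unfolding dvd_iff_const_coeff_multiples_zero[OF assms(2)]
      using orth[rule_format, of _ 0 0 1] by (simp add: herm mult.assoc conj_recip_zero[OF card])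
    show "?P dvd g11 * ?J g11 + g12 * ?J g12"
      unfolding dvd_iff_const_coeff_multiples_zero[OF assms(2)]
      using orth[rule_format, of _ 0 1 0] by (simp add: herm distrib_left mult.assoc)
  next
    fix r s r' s'
    assume dvd: "?P dvd g22 * ?J g22 \<and> ?P dvd g12 * ?J g22 \<and> ?P dvd g11 * ?J g11 + g12 * ?J g12"
    have "?P dvd ?J (g12 * ?J g22)"
      using dvd cyc_poly_dvd_conj_recip[OF card] by blast
    moreover have "[?J g12 * ?J (?J g22) = ?J g12 * g22] (mod ?P)"
      by (intro cong_mult cong_refl conj_recip_conj_recip[OF card] assms(2))
    ultimately have dvd': "?P dvd g22 * ?J g12"
      by (simp add: conj_recip_mult[OF card] cong_dvd_iff mult.commute)
    \<comment> \<open>Sesquilinear expansion, grouped by pairs of generators; the third group is the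
      one settled by \<open>dvd'\<close>.\<close>
    have "(r * g11) * ?J (r' * g11) + (r * g12 + s * g22) * ?J (r' * g12 + s' * g22) =
        r * ?J r' * (g11 * ?J g11 + g12 * ?J g12) + r * ?J s' * (g12 * ?J g22) +
        s * ?J r' * (g22 * ?J g12) + s * ?J s' * (g22 * ?J g22)"
      by (simp add: conj_recip_mult[OF card] conj_recip_add[OF card] algebra_simps)
    also have "?P dvd \<dots>"
      using dvd dvd' by (intro dvd_add; simp add: dvd_mult)
    finally show "herm_sq q m (?u r s) (?u r' s') = 0"
      by (simp add: herm const_coeff_def)
  qed
qed

end
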